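(* If a permutation $\pi$ has opposing adjacencies, then $\mu[1,\pi]=0$.
   Context: Permutations are ordered by classical pattern containment ($\sigma\le\pi$ if $\pi$ has a subsequence order-isomorphic to $\sigma$), and $\mu[\sigma,\pi]$ is the Möbius function of this poset: $\mu[\sigma,\sigma]=1$, $\mu[\sigma,\pi]=0$ if $\sigma\not\le\pi$, and $\mu[\sigma,\pi]=-\sum_{\sigma\le\lambda<\pi}\mu[\sigma,\lambda]$ if $\sigma<\pi$. Here $1$ denotes the permutation of length one. An adjacency in $\pi$ is an interval of length two, i.e. a pair of consecutive positions $i,i+1$ with $|\pi_i-\pi_{i+1}|=1$. It is an up-adjacency if $\pi_{i+1}=\pi_i+1$ and a down-adjacency if $\pi_{i+1}=\pi_i-1$. A permutation has opposing adjacencies if it has at least one up-adjacency and at least one down-adjacency. *)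

theory Defs
  imports "HOL-Library.Sublist" "HOL-Combinatorics.Multiset_Permutations"
begin

text \<open>
  A permutation of length \<open>n\<close> is given in one-line notation, as a list containing each of
  \<open>1, \<dots>, n\<close> exactly once. List positions count from 0, entries from 1.
\<close>

definition is_perm :: "nat list \<Rightarrow> bool" where
  "is_perm p \<longleftrightarrow> p \<in> permutations_of_set {1..length p}"

definition order_isomorphic :: "nat list \<Rightarrow> nat list \<Rightarrow> bool" where
  "order_isomorphic xs ys \<longleftrightarrow> length xs = length ys \<and>
     (\<forall>i < length xs. \<forall>j < length xs. xs ! i < xs ! j \<longleftrightarrow> ys ! i < ys ! j)"

definition pattern_le :: "nat list \<Rightarrow> nat list \<Rightarrow> bool" (infix "\<preceq>" 50) where
  "s \<preceq> p \<longleftrightarrow> (\<exists>t. subseq t p \<and> order_isomorphic s t)"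

definition pattern_less :: "nat list \<Rightarrow> nat list \<Rightarrow> bool" (infix "\<prec>" 50) where
  "s \<prec> p \<longleftrightarrow> s \<preceq> p \<and> s \<noteq> p"

lemma order_isomorphic_refl: "order_isomorphic xs xs"
  by (simp add: order_isomorphic_def)

lemma order_isomorphic_sym: "order_isomorphic xs ys \<Longrightarrow> order_isomorphic ys xs"
  by (auto simp: order_isomorphic_def)

lemma order_isomorphic_trans:
  "order_isomorphic xs ys \<Longrightarrow> order_isomorphic ys zs \<Longrightarrow> order_isomorphic xs zs"
  by (auto simp: order_isomorphic_def)

lemma is_perm_iff: "is_perm p \<longleftrightarrow> distinct p \<and> set p = {1..length p}"
  by (auto simp: is_perm_def permutations_of_set_def)

lemma is_perm_nth:
  assumes "is_perm p" "i < length p"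
  shows "p ! i = Suc (card {j. j < length p \<and> p ! j < p ! i})"
proof -
  have p: "distinct p" "set p = {1..length p}"
    using assms(1) by (auto simp: is_perm_iff)
  have "p ! i \<in> {1..length p}"
    using assms(2) p(2) nth_mem by blast
  have "(!) p ` {j. j < length p \<and> p ! j < p ! i} = {x \<in> set p. x < p ! i}"
    by (auto simp: in_set_conv_nth)
  also have "\<dots> = {1..<p ! i}"
    using p(2) \<open>p ! i \<in> {1..length p}\<close> by auto
  finally have "card ((!) p ` {j. j < length p \<and> p ! j < p ! i}) = p ! i - 1"
    by simp
  moreover have "inj_on ((!) p) {j. j < length p \<and> p ! j < p ! i}"
    using p(1) by (auto simp: inj_on_def nth_eq_iff_index_eq)
  ultimately show ?thesis
    using \<open>p ! i \<in> {1..length p}\<close> by (simp add: card_image)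
qed

lemma order_isomorphic_perm_eq:
  assumes "is_perm p" "is_perm q" "order_isomorphic p q"
  shows "p = q"
proof (rule nth_equalityI)
  show len: "length p = length q"
    using assms(3) by (simp add: order_isomorphic_def)
  fix i assume i: "i < length p"
  have "{j. j < length p \<and> p ! j < p ! i} = {j. j < length q \<and> q ! j < q ! i}"
    using assms(3) i by (auto simp: order_isomorphic_def)
  then show "p ! i = q ! i"
    using is_perm_nth[OF assms(1) i] is_perm_nth[OF assms(2), of i] i len by simp
qed

lemma pattern_le_length: "s \<preceq> p \<Longrightarrow> length s \<le> length p"
  by (auto simp: pattern_le_def order_isomorphic_def dest: list_emb_length)

lemma pattern_le_refl: "p \<preceq> p"
  unfolding pattern_le_def using order_isomorphic_refl by blast

lemma pattern_le_same_length:
  assumes "is_perm s" "is_perm p" "s \<preceq> p" "length s = length p"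
  shows "s = p"
proof -
  obtain t where t: "subseq t p" "order_isomorphic s t"
    using assms(3) by (auto simp: pattern_le_def)
  then have "t = p"
    using assms(4) subseq_same_length by (fastforce simp: order_isomorphic_def)
  then show ?thesis
    using order_isomorphic_perm_eq assms t by blast
qed

lemma pattern_le_antisym:
  assumes "is_perm s" "is_perm p" "s \<preceq> p" "p \<preceq> s"
  shows "s = p"
  using assms pattern_le_same_length pattern_le_length le_antisym by metis

lemma order_isomorphic_nths:
  assumes "order_isomorphic xs ys"
  shows "order_isomorphic (nths xs I) (nths ys I)"
  using assms
proof (induction xs arbitrary: ys I rule: rev_induct)
  case Nil
  then show ?case by (simp add: order_isomorphic_def)
next
  case (snoc x xs)
  obtain y ys' where ys: "ys = ys' @ [y]"
    using snoc.prems by (cases ys rule: rev_cases) (auto simp: order_isomorphic_def)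
  have len: "length xs = length ys'"
    using snoc.prems ys by (simp add: order_isomorphic_def)
  have all: "(xs @ [x]) ! i < (xs @ [x]) ! j \<longleftrightarrow> (ys' @ [y]) ! i < (ys' @ [y]) ! j"
    if "i < Suc (length xs)" "j < Suc (length xs)" for i j
    using snoc.prems that unfolding ys order_isomorphic_def by simp
  have nth: "xs ! i < xs ! j \<longleftrightarrow> ys' ! i < ys' ! j"
    if "i < length xs" "j < length xs" for i j
    using all[of i j] that len by (simp add: nth_append)
  have last: "xs ! i < x \<longleftrightarrow> ys' ! i < y" "x < xs ! i \<longleftrightarrow> y < ys' ! i"
    if "i < length xs" for i
    using all[of i "length xs"] all[of "length xs" i] that len by (simp_all add: nth_append)
  have "order_isomorphic xs ys'"
    using nth len by (simp add: order_isomorphic_def)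
  then have IH: "order_isomorphic (nths xs I) (nths ys' I)"
    by (rule snoc.IH)
  have zip: "\<exists>k < length xs. nths xs I ! i = xs ! k \<and> nths ys' I ! i = ys' ! k"
    if "i < length (nths xs I)" for i
  proof -
    have l: "length (nths xs I) = length (nths ys' I)"
      using IH by (simp add: order_isomorphic_def)
    have "nths (zip xs ys') I = zip (nths xs I) (nths ys' I)"
    proof -
      have "map fst (nths (zip xs ys') I) = nths xs I" "map snd (nths (zip xs ys') I) = nths ys' I"
        using len by (simp_all flip: nths_map)
      then show ?thesis by (metis zip_map_fst_snd)
    qed
    then have "(nths xs I ! i, nths ys' I ! i) \<in> set (nths (zip xs ys') I)"
      using that l by (auto simp: in_set_conv_nth intro!: exI[of _ i])
    then have "(nths xs I ! i, nths ys' I ! i) \<in> set (zip xs ys')"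
      using notin_set_nthsI by fastforce
    then show ?thesis by (auto simp: in_set_conv_nth)
  qed
  show ?case
  proof (cases "length xs \<in> I")
    case False
    then show ?thesis using IH len ys by (simp add: nths_append)
  next
    case True
    have l: "length (nths xs I) = length (nths ys' I)"
      using IH by (simp add: order_isomorphic_def)
    have "(nths xs I @ [x]) ! i < (nths xs I @ [x]) ! j
        \<longleftrightarrow> (nths ys' I @ [y]) ! i < (nths ys' I @ [y]) ! j"
      if i: "i < Suc (length (nths xs I))" and j: "j < Suc (length (nths xs I))" for i j
    proof (cases "i < length (nths xs I)"; cases "j < length (nths xs I)")
      assume "i < length (nths xs I)" "j < length (nths xs I)"
      then show ?thesis using IH l by (simp add: order_isomorphic_def nth_append)
    next
      assume a: "i < length (nths xs I)" "\<not> j < length (nths xs I)"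
      then have "j = length (nths xs I)" using j by simp
      then show ?thesis using a(1) zip[OF a(1)] last l by (auto simp: nth_append)
    next
      assume a: "\<not> i < length (nths xs I)" "j < length (nths xs I)"
      then have "i = length (nths xs I)" using i by simp
      then show ?thesis using a(2) zip[OF a(2)] last l by (auto simp: nth_append)
    next
      assume a: "\<not> i < length (nths xs I)" "\<not> j < length (nths xs I)"
      then have "i = length (nths xs I)" "j = length (nths xs I)" using i j by simp_all
      then show ?thesis by simp
    qed
    then show ?thesis
      using True len ys l by (simp add: nths_append order_isomorphic_def)
  qed
qed

lemma pattern_le_trans:
  assumes "s \<preceq> p" "p \<preceq> q"
  shows "s \<preceq> q"
proof -
  obtain t u where t: "subseq t p" "order_isomorphic s t"
    and u: "subseq u q" "order_isomorphic p u"
    using assms by (auto simp: pattern_le_def)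
  obtain I where I: "t = nths p I"
    using t(1) by (auto simp: subseq_conv_nths)
  have "subseq (nths u I) u"
    by (auto simp: subseq_conv_nths)
  then have "subseq (nths u I) q"
    using u(1) subseq_order.trans by blast
  moreover have "order_isomorphic s (nths u I)"
    using t(2) order_isomorphic_nths[OF u(2), of I] I order_isomorphic_trans by blast
  ultimately show ?thesis
    by (auto simp: pattern_le_def)
qed

lemma pattern_less_length:
  assumes "is_perm s" "is_perm p" "s \<prec> p"
  shows "length s < length p"
  using assms pattern_le_same_length pattern_le_length
  by (metis le_neq_implies_less pattern_less_def)

text \<open>
  The Moebius function of the poset of permutations; it is 0 by convention on
  lists that are not permutations.
\<close>

function mobius :: "nat list \<Rightarrow> nat list \<Rightarrow> int" where
  "mobius s p =
     (if \<not> (is_perm s \<and> is_perm p) then 0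
      else if s = p then 1
      else if \<not> s \<preceq> p then 0
      else - (\<Sum>l | is_perm l \<and> s \<preceq> l \<and> l \<prec> p. mobius s l))"
  by auto
termination
  by (relation "measure (length \<circ> snd)") (auto intro: pattern_less_length)

declare mobius.simps [simp del]

lemma finite_below: "finite {l. is_perm l \<and> s \<preceq> l \<and> l \<prec> p}"
proof (rule finite_subset)
  show "finite {l. set l \<subseteq> {1..length p} \<and> length l \<le> length p}"
    by (rule finite_lists_length_le) simp
  have "set l \<subseteq> {1..length p}" "length l \<le> length p" if "is_perm l" "l \<prec> p" for l
    using that pattern_le_length[of l p] by (auto simp: is_perm_iff pattern_less_def)
  then show "{l. is_perm l \<and> s \<preceq> l \<and> l \<prec> p}
      \<subseteq> {l. set l \<subseteq> {1..length p} \<and> length l \<le> length p}"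
    by blast
qed

lemma mobius_same: "is_perm s \<Longrightarrow> mobius s s = 1"
  by (simp add: mobius.simps)

lemma mobius_not_le: "\<not> s \<preceq> p \<Longrightarrow> mobius s p = 0"
  using pattern_le_refl by (auto simp: mobius.simps)

lemma mobius_less:
  assumes "is_perm s" "is_perm p" "s \<prec> p"
  shows "mobius s p = - (\<Sum>l | is_perm l \<and> s \<preceq> l \<and> l \<prec> p. mobius s l)"
  using assms by (subst mobius.simps) (simp add: pattern_less_def)

definition up_adjacency :: "nat list \<Rightarrow> nat \<Rightarrow> bool" where
  "up_adjacency p i \<longleftrightarrow> i + 1 < length p \<and> p ! (i + 1) = p ! i + 1"

text \<open>
  The defining equation \<open>p ! (i + 1) = p ! i - 1\<close> is written without truncated subtraction.
\<close>

definition down_adjacency :: "nat list \<Rightarrow> nat \<Rightarrow> bool" where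
  "down_adjacency p i \<longleftrightarrow> i + 1 < length p \<and> p ! (i + 1) + 1 = p ! i"

definition opposing_adjacencies :: "nat list \<Rightarrow> bool" where
  "opposing_adjacencies p \<longleftrightarrow> (\<exists>i. up_adjacency p i) \<and> (\<exists>j. down_adjacency p j)"

end

theory Submission
  imports Defs
begin

text \<open>
  The argument is an inclusion-exclusion over three copies of \<open>\<pi>\<close> with entries deleted.  Let
  \<open>\<pi>\<close> have an up-adjacency at \<open>i\<close> and a down-adjacency at \<open>j\<close>, and let \<open>\<alpha>\<close>, \<open>\<beta>\<close>, \<open>\<gamma>\<close> be \<open>\<pi>\<close>
  without its entry at \<open>i\<close>, at \<open>j\<close>, and at both positions.

  An occurrence of a permutation \<open>\<tau>\<close> that uses both entries of an up-adjacency of \<open>\<pi>\<close> exhibits an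
  up-adjacency of \<open>\<tau>\<close>, as no entry of \<open>\<pi>\<close> has a position or value strictly between them.  So an
  occurrence of a \<open>\<tau>\<close> without up-adjacencies uses at most one of the two entries, and as they are
  interchangeable it can be moved off position \<open>i\<close>
  (\<open>pattern_le_delete_up_adjacency\<close>).  Hence, for such \<open>\<tau>\<close>, we have \<open>\<tau> \<le> \<pi>\<close> iff \<open>\<tau> \<le> \<alpha>\<close>, and
  \<open>\<tau> \<le> \<beta>\<close> iff \<open>\<tau> \<le> \<gamma>\<close>.  Symmetrically, when \<open>\<tau>\<close> has no down-adjacencies, \<open>\<tau> \<le> \<pi>\<close> iff
  \<open>\<tau> \<le> \<beta>\<close>, and \<open>\<tau> \<le> \<alpha>\<close> iff \<open>\<tau> \<le> \<gamma>\<close>.  In both cases the truth values satisfy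

    \<open>[\<tau> \<le> \<pi>] = [\<tau> \<le> \<alpha>] + [\<tau> \<le> \<beta>] - [\<tau> \<le> \<gamma>]\<close>.

  By induction on the length, every \<open>\<tau> < \<pi>\<close> with opposing adjacencies has \<open>\<mu>[1,\<tau>] = 0\<close>, so only
  the two cases above matter.  None of \<open>\<alpha>\<close>, \<open>\<beta>\<close>, \<open>\<gamma>\<close> contains \<open>\<pi>\<close>, so the recurrence for
  \<open>\<mu>[1,\<pi>]\<close> becomes

    \<open>-\<mu>[1,\<pi>] = (\<Sum>\<tau> \<le> \<alpha>. \<mu>[1,\<tau>]) + (\<Sum>\<tau> \<le> \<beta>. \<mu>[1,\<tau>]) - (\<Sum>\<tau> \<le> \<gamma>. \<mu>[1,\<tau>])\<close>.

  The two adjacencies have no entry in common, so \<open>\<pi>\<close> has length at least 4 and \<open>\<gamma>\<close> has length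
  at least 2.  Each of the three sums therefore runs over a nontrivial closed interval of the poset
  and vanishes (\<open>sum_mobius_one_pattern_le\<close>).
\<close>

section \<open>Standardization\<close>

text \<open>
  Deleting entries from a permutation leaves a word of distinct numbers that need not be
  \<open>1, \<dots>, n\<close>.  Pattern containment sees only relative order, so such words can stand for
  permutations.
\<close>

lemma ex_standardization:
  assumes "distinct w"
  shows "\<exists>s. is_perm s \<and> order_isomorphic s w"
proof -
  define rank where "rank x = Suc (card {y \<in> set w. y < x})" for x
  have rank_mono: "rank x < rank y" if "x \<in> set w" "x < y" for x y
    unfolding rank_def using that by (intro Suc_mono psubset_card_mono) auto
  have rank_iff: "rank x < rank y \<longleftrightarrow> x < y" if "x \<in> set w" "y \<in> set w" for x y
    using rank_mono[of x y] rank_mono[of y x] that by (cases x y rule: linorder_cases) auto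
  have inj: "inj_on rank (set w)"
    by (rule inj_onI) (metis less_irrefl neqE rank_mono)
  have "rank x \<le> length w" if "x \<in> set w" for x
  proof -
    have "card {y \<in> set w. y < x} < card (set w)"
      using that by (intro psubset_card_mono) auto
    then show ?thesis
      using assms by (simp add: rank_def distinct_card)
  qed
  then have "rank ` set w \<subseteq> {1..length w}"
    by (auto simp: rank_def)
  moreover have "card (rank ` set w) = card {1..length w}"
    using inj assms by (simp add: card_image distinct_card)
  ultimately have "rank ` set w = {1..length w}"
    by (intro card_subset_eq) auto
  then have "is_perm (map rank w)"
    using inj assms by (simp add: is_perm_iff distinct_map)
  moreover have "order_isomorphic (map rank w) w"
    by (simp add: order_isomorphic_def rank_iff)
  ultimately show ?thesis
    by blast
qed

lemma pattern_le_order_isomorphic: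
  assumes "order_isomorphic s w"
  shows "l \<preceq> s \<longleftrightarrow> l \<preceq> w"
proof -
  have "s \<preceq> w" "w \<preceq> s"
    using assms order_isomorphic_sym by (auto simp: pattern_le_def)
  then show ?thesis
    using pattern_le_trans by blast
qed

section \<open>Sums of the Moebius function over closed intervals\<close>

lemma sum_mobius_closed_interval:
  assumes "is_perm s" "is_perm p" "s \<prec> p"
  shows "(\<Sum>l | is_perm l \<and> s \<preceq> l \<and> l \<preceq> p. mobius s l) = 0"
proof -
  have "{l. is_perm l \<and> s \<preceq> l \<and> l \<preceq> p} = insert p {l. is_perm l \<and> s \<preceq> l \<and> l \<prec> p}"
    using assms by (auto simp: pattern_less_def intro: pattern_le_refl)
  moreover have "p \<notin> {l. is_perm l \<and> s \<preceq> l \<and> l \<prec> p}"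
    by (simp add: pattern_less_def)
  ultimately show ?thesis
    by (simp add: finite_below mobius_less[OF assms])
qed

lemma sum_mobius_one_pattern_le:
  assumes "distinct w" "2 \<le> length w"
  shows "(\<Sum>l | is_perm l \<and> [1] \<preceq> l \<and> l \<preceq> w. mobius [1] l) = 0"
proof -
  obtain s where s: "is_perm s" "order_isomorphic s w"
    using ex_standardization[OF assms(1)] by blast
  then have len: "2 \<le> length s"
    using assms(2) by (simp add: order_isomorphic_def)
  then have "subseq [hd s] s"
    by (cases s) auto
  then have "[1] \<preceq> s"
    unfolding pattern_le_def by (intro exI[of _ "[hd s]"]) (simp add: order_isomorphic_def)
  then have "[1] \<prec> s"
    using len by (auto simp: pattern_less_def)
  moreover have "is_perm [1]"
    by (simp add: is_perm_iff)
  ultimately show ?thesis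
    using sum_mobius_closed_interval[of "[1]" s] s
    by (simp add: pattern_le_order_isomorphic)
qed

section \<open>Occurrences as increasing lists of positions\<close>

lemma nths_eq_map_filter: "nths p I = map ((!) p) (filter (\<lambda>k. k \<in> I) [0..<length p])"
proof -
  have "nths p I = nths (map ((!) p) [0..<length p]) I"
    by (simp add: map_nth)
  also have "\<dots> = map ((!) p) (nths [0..<length p] I)"
    by (simp add: nths_map)
  also have "nths [0..<n] I = filter (\<lambda>k. k \<in> I) [0..<n]" for n
    by (induction n) (auto simp: nths_append)
  finally show ?thesis .
qed

lemma subseq_map_iff: "subseq t (map f ys) \<longleftrightarrow> (\<exists>xs. subseq xs ys \<and> t = map f xs)"
  by (auto simp: subseq_conv_nths nths_map)

lemma subseq_filter_upt_iff:
  "subseq js (filter P [0..<n]) \<longleftrightarrow> sorted_wrt (<) js \<and> (\<forall>k \<in> set js. k < n \<and> P k)"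
proof (intro iffI conjI)
  assume sub: "subseq js (filter P [0..<n])"
  have "sorted_wrt (<) (filter P [0..<n])"
    by (simp add: sorted_wrt_filter)
  then show "sorted_wrt (<) js"
    using sub by (auto simp: subseq_conv_nths strict_sorted_iff sorted_nths)
  have "set js \<subseteq> set (filter P [0..<n])"
    using sub by (auto simp: subseq_conv_nths dest: in_set_nthsD)
  then show "\<forall>k \<in> set js. k < n \<and> P k"
    by auto
next
  assume js: "sorted_wrt (<) js \<and> (\<forall>k \<in> set js. k < n \<and> P k)"
  then have "set (filter (\<lambda>k. k \<in> set js) (filter P [0..<n])) = set js"
    by auto
  moreover have "sorted_wrt (<) (filter (\<lambda>k. k \<in> set js) (filter P [0..<n]))"
    by (simp add: sorted_wrt_filter)
  ultimately have eq: "filter (\<lambda>k. k \<in> set js) (filter P [0..<n]) = js"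
    using js strict_sorted_equal by blast
  show "subseq js (filter P [0..<n])"
    by (subst eq[symmetric]) (rule subseq_filter_left)
qed

text \<open>
  Recording an occurrence by its positions, rather than as a subsequence, makes it possible to ask
  whether it uses a given entry and to exchange one entry for another.
\<close>

lemma pattern_le_nths_iff:
  "s \<preceq> nths p I \<longleftrightarrow>
     (\<exists>js. sorted_wrt (<) js \<and> set js \<subseteq> {..<length p} \<inter> I \<and> order_isomorphic s (map ((!) p) js))"
  unfolding pattern_le_def nths_eq_map_filter subseq_map_iff subseq_filter_upt_iff
  by (auto simp: subset_eq)

section \<open>Moving an occurrence within an adjacency\<close>

text \<open>
  If the two entries of \<open>s\<close> were not consecutive in value, the value right above the smaller one
  would occur in the permutation \<open>s\<close> and correspond to an entry of \<open>t\<close> strictly between two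
  consecutive integers.
\<close>

lemma up_adjacency_order_isomorphic:
  assumes "is_perm s" "order_isomorphic s t" "up_adjacency t k"
  shows "up_adjacency s k"
proof -
  have iso: "s ! a < s ! b \<longleftrightarrow> t ! a < t ! b" if "a < length s" "b < length s" for a b
    using assms(2) that by (simp add: order_isomorphic_def)
  have t: "t ! (k + 1) = t ! k + 1"
    using assms by (simp add: up_adjacency_def)
  have k: "k + 1 < length s"
    using assms by (simp add: order_isomorphic_def up_adjacency_def)
  have less: "s ! k < s ! (k + 1)"
    using iso[of k "k + 1"] k t by simp
  have "s ! (k + 1) \<in> {1..length s}"
    using assms(1) k nth_mem unfolding is_perm_iff by blast
  then have "s ! k + 1 \<in> set s"
    using assms(1) less by (simp add: is_perm_iff)
  then obtain m where m: "m < length s" "s ! m = s ! k + 1"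
    by (auto simp: in_set_conv_nth)
  have "\<not> s ! m < s ! (k + 1)"
    using iso[of k m] iso[of m "k + 1"] m k t by auto
  then show ?thesis
    using m less k by (simp add: up_adjacency_def)
qed

lemma down_adjacency_order_isomorphic:
  assumes "is_perm s" "order_isomorphic s t" "down_adjacency t k"
  shows "down_adjacency s k"
proof -
  have iso: "s ! a < s ! b \<longleftrightarrow> t ! a < t ! b" if "a < length s" "b < length s" for a b
    using assms(2) that by (simp add: order_isomorphic_def)
  have t: "t ! (k + 1) + 1 = t ! k"
    using assms by (simp add: down_adjacency_def)
  have k: "k + 1 < length s"
    using assms by (simp add: order_isomorphic_def down_adjacency_def)
  have less: "s ! (k + 1) < s ! k"
    using iso[of "k + 1" k] k t by simp
  have "s ! k \<in> {1..length s}"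
    using assms(1) k nth_mem[of k s] unfolding is_perm_iff by auto
  then have "s ! (k + 1) + 1 \<in> set s"
    using assms(1) less by (simp add: is_perm_iff)
  then obtain m where m: "m < length s" "s ! m = s ! (k + 1) + 1"
    by (auto simp: in_set_conv_nth)
  have "\<not> s ! m < s ! k"
    using iso[of "k + 1" m] iso[of m k] m k t by auto
  then show ?thesis
    using m less k by (simp add: down_adjacency_def)
qed

lemma consecutive_members_of_strictly_sorted:
  fixes js :: "nat list"
  assumes "sorted_wrt (<) js" "i \<in> set js" "i + 1 \<in> set js"
  shows "\<exists>k. k + 1 < length js \<and> js ! k = i \<and> js ! (k + 1) = i + 1"
proof -
  obtain a b where a: "a < length js" "js ! a = i" and b: "b < length js" "js ! b = i + 1"
    using assms by (auto simp: in_set_conv_nth)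
  have mono: "js ! x < js ! y" if "x < y" "y < length js" for x y
    using assms(1) that by (simp add: sorted_wrt_nth_less)
  have "a < b"
    using mono[of b a] a b by (cases a b rule: linorder_cases) auto
  moreover have "\<not> a + 1 < b"
    using mono[of a "a + 1"] mono[of "a + 1" b] a b by auto
  ultimately have "b = a + 1"
    by simp
  then show ?thesis
    using a b by blast
qed

text \<open>
  The two entries of an adjacency compare in the same way with every other entry, in position and
  in value, so an occurrence that uses at most one of them may use the right one.
\<close>

lemma pattern_le_move_off_adjacency:
  assumes "distinct p" and i: "i + 1 < length p"
    and adj: "p ! (i + 1) = p ! i + 1 \<or> p ! (i + 1) + 1 = p ! i"
    and js: "sorted_wrt (<) js" "set js \<subseteq> {..<length p} \<inter> - K"
      "order_isomorphic s (map ((!) p) js)"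
    and not_both: "\<not> (i \<in> set js \<and> i + 1 \<in> set js)" and K: "i + 1 \<notin> K"
  shows "s \<preceq> nths p (- insert i K)"
proof -
  define move where "move k = (if k = i then i + 1 else k)" for k
  have val: "p ! a < p ! b \<longleftrightarrow> p ! move a < p ! move b" if ab: "a \<in> set js" "b \<in> set js" for a b
  proof -
    have other: "p ! c \<noteq> p ! i" "p ! c \<noteq> p ! (i + 1)" if "c \<in> set js" "c \<noteq> i" "i \<in> set js" for c
    proof -
      have "c < length p" "c \<noteq> i + 1"
        using that js(2) not_both by auto
      then show "p ! c \<noteq> p ! i" "p ! c \<noteq> p ! (i + 1)"
        using that(2) i by (simp_all add: nth_eq_iff_index_eq[OF assms(1)])
    qed
    consider "a = i" "b = i" | "a = i" "b \<noteq> i" | "a \<noteq> i" "b = i" | "a \<noteq> i" "b \<noteq> i"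
      by blast
    then show ?thesis
    proof cases
      case 2
      then have "p ! b \<noteq> p ! i" "p ! b \<noteq> p ! (i + 1)"
        using ab other[of b] by simp_all
      then show ?thesis
        using adj 2 by (auto simp: move_def)
    next
      case 3
      then have "p ! a \<noteq> p ! i" "p ! a \<noteq> p ! (i + 1)"
        using ab other[of a] by simp_all
      then show ?thesis
        using adj 3 by (auto simp: move_def)
    qed (simp_all add: move_def)
  qed
  have "move a < move b" if "a \<in> set js" "b \<in> set js" "a < b" for a b
  proof (cases "a = i")
    case True
    then have "b \<noteq> i + 1"
      using that not_both by blast
    then show ?thesis
      using True that by (simp add: move_def)
  qed (use that in \<open>simp add: move_def\<close>)
  then have "sorted_wrt (\<lambda>a b. move a < move b) js"
    by (rule sorted_wrt_mono_rel[OF _ js(1)])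
  then have "sorted_wrt (<) (map move js)"
    by (simp add: sorted_wrt_map)
  moreover have "set (map move js) \<subseteq> {..<length p} \<inter> - insert i K"
    using js(2) i K by (auto simp: move_def)
  moreover have "order_isomorphic (map ((!) p) js) (map ((!) p) (map move js))"
    using val by (simp add: order_isomorphic_def)
  then have "order_isomorphic s (map ((!) p) (map move js))"
    using js(3) order_isomorphic_trans by blast
  ultimately show ?thesis
    unfolding pattern_le_nths_iff by blast
qed

text \<open>
  The deleted set \<open>K\<close> serves to apply this both to a permutation and to the permutation with an
  entry of its other adjacency removed.
\<close>

lemma pattern_le_delete_up_adjacency:
  assumes "distinct p" "up_adjacency p i" "i + 1 \<notin> K"
    and "is_perm s" "\<nexists>k. up_adjacency s k" "s \<preceq> nths p (- K)"
  shows "s \<preceq> nths p (- insert i K)"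
proof -
  obtain js where js: "sorted_wrt (<) js" "set js \<subseteq> {..<length p} \<inter> - K"
    "order_isomorphic s (map ((!) p) js)"
    using assms(6) by (auto simp: pattern_le_nths_iff)
  have "\<not> (i \<in> set js \<and> i + 1 \<in> set js)"
  proof
    assume "i \<in> set js \<and> i + 1 \<in> set js"
    then obtain k where "k + 1 < length js" "js ! k = i" "js ! (k + 1) = i + 1"
      using consecutive_members_of_strictly_sorted js(1) by blast
    then have "up_adjacency (map ((!) p) js) k"
      using assms(2) by (simp add: up_adjacency_def)
    then show False
      using up_adjacency_order_isomorphic assms(4,5) js(3) by blast
  qed
  then show ?thesis
    using pattern_le_move_off_adjacency[OF assms(1) _ _ js] assms(2,3)
    by (simp add: up_adjacency_def)
qed

lemma pattern_le_delete_down_adjacency: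
  assumes "distinct p" "down_adjacency p i" "i + 1 \<notin> K"
    and "is_perm s" "\<nexists>k. down_adjacency s k" "s \<preceq> nths p (- K)"
  shows "s \<preceq> nths p (- insert i K)"
proof -
  obtain js where js: "sorted_wrt (<) js" "set js \<subseteq> {..<length p} \<inter> - K"
    "order_isomorphic s (map ((!) p) js)"
    using assms(6) by (auto simp: pattern_le_nths_iff)
  have "\<not> (i \<in> set js \<and> i + 1 \<in> set js)"
  proof
    assume "i \<in> set js \<and> i + 1 \<in> set js"
    then obtain k where "k + 1 < length js" "js ! k = i" "js ! (k + 1) = i + 1"
      using consecutive_members_of_strictly_sorted js(1) by blast
    then have "down_adjacency (map ((!) p) js) k"
      using assms(2) by (simp add: down_adjacency_def)
    then show False
      using down_adjacency_order_isomorphic assms(4,5) js(3) by blast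
  qed
  then show ?thesis
    using pattern_le_move_off_adjacency[OF assms(1) _ _ js] assms(2,3)
    by (simp add: down_adjacency_def)
qed

section \<open>Inclusion-exclusion over the two adjacencies\<close>

lemma opposing_adjacencies_disjoint:
  assumes "distinct p" "up_adjacency p i" "down_adjacency p j"
  shows "{i, i + 1} \<inter> {j, j + 1} = {}"
proof -
  have "i \<noteq> j"
    using assms by (auto simp: up_adjacency_def down_adjacency_def)
  \<comment> \<open>Were the adjacencies to share one position, the two outer entries would be equal.\<close>
  moreover have "j \<noteq> i + 1"
    using assms nth_eq_iff_index_eq[OF assms(1), of i "i + 2"]
    by (auto simp: up_adjacency_def down_adjacency_def)
  moreover have "i \<noteq> j + 1"
    using assms nth_eq_iff_index_eq[OF assms(1), of j "j + 2"]
    by (auto simp: up_adjacency_def down_adjacency_def)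
  ultimately show ?thesis
    by auto
qed

lemma pattern_le_nths_mono:
  assumes "s \<preceq> nths p I" "I \<subseteq> J"
  shows "s \<preceq> nths p J"
proof -
  obtain js where "sorted_wrt (<) js" "set js \<subseteq> {..<length p} \<inter> I"
    "order_isomorphic s (map ((!) p) js)"
    using assms(1) by (auto simp: pattern_le_nths_iff)
  then show ?thesis
    using assms(2) unfolding pattern_le_nths_iff by (intro exI[of _ js]) auto
qed

lemma pattern_le_opposing_inclusion_exclusion:
  assumes "distinct p" "up_adjacency p i" "down_adjacency p j"
    and "is_perm s" "\<not> opposing_adjacencies s"
  shows "(of_bool (s \<preceq> p) :: int) =
    of_bool (s \<preceq> nths p (- {i})) + of_bool (s \<preceq> nths p (- {j})) - of_bool (s \<preceq> nths p (- {i, j}))"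
proof -
  have disj: "i + 1 \<noteq> j" "j + 1 \<noteq> i"
    using opposing_adjacencies_disjoint[OF assms(1-3)] by auto
  have p: "nths p UNIV = p"
    by (simp add: nths_all)
  have mono: "s \<preceq> nths p (- {i, j}) \<Longrightarrow> s \<preceq> nths p (- {i})" "s \<preceq> nths p (- {i, j}) \<Longrightarrow> s \<preceq> nths p (- {j})"
    "s \<preceq> nths p (- {i}) \<Longrightarrow> s \<preceq> p" "s \<preceq> nths p (- {j}) \<Longrightarrow> s \<preceq> p"
    using pattern_le_nths_mono[of s p _ UNIV] pattern_le_nths_mono[of s p "- {i, j}"]
    by (auto simp: p)
  from assms(5) consider "\<nexists>k. up_adjacency s k" | "\<nexists>k. down_adjacency s k"
    by (auto simp: opposing_adjacencies_def)
  then show ?thesis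
  proof cases
    case 1
    note delete = pattern_le_delete_up_adjacency[OF assms(1,2) _ assms(4) 1]
    have "s \<preceq> p \<Longrightarrow> s \<preceq> nths p (- {i})"
      using delete[of "{}"] by (simp add: p)
    moreover have "s \<preceq> nths p (- {j}) \<Longrightarrow> s \<preceq> nths p (- {i, j})"
      using delete[of "{j}"] disj by simp
    ultimately show ?thesis
      using mono by (auto simp del: Compl_insert)
  next
    case 2
    note delete = pattern_le_delete_down_adjacency[OF assms(1,3) _ assms(4) 2]
    have "s \<preceq> p \<Longrightarrow> s \<preceq> nths p (- {j})"
      using delete[of "{}"] by (simp add: p)
    moreover have "s \<preceq> nths p (- {i}) \<Longrightarrow> s \<preceq> nths p (- {i, j})"
      using delete[of "{i}"] disj by (simp add: insert_commute)
    ultimately show ?thesis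
      using mono by (auto simp del: Compl_insert)
  qed
qed

theorem theorem31:
  fixes p :: "nat list"
  assumes "is_perm p"
    and "opposing_adjacencies p"
  shows "mobius [1] p = 0"
  using assms
proof (induction "length p" arbitrary: p rule: less_induct)
  case less
  have dist: "distinct p"
    using less.prems(1) by (simp add: is_perm_iff)
  obtain i j where ij: "up_adjacency p i" "down_adjacency p j"
    using less.prems(2) by (auto simp: opposing_adjacencies_def)
  then have bounds: "i + 1 < length p" "j + 1 < length p"
    by (auto simp: up_adjacency_def down_adjacency_def)
  have disj: "{i, i + 1} \<inter> {j, j + 1} = {}"
    by (rule opposing_adjacencies_disjoint[OF dist ij])
  define below where "below = {l. is_perm l \<and> [1] \<preceq> l \<and> l \<prec> p}"
  define S where "S K = (\<Sum>l\<in>below. of_bool (l \<preceq> nths p (- K)) * mobius [1] l)" for K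
  \<comment> \<open>\<open>S K\<close> is a sum over a closed interval: the word \<open>nths p (- K)\<close> is shorter than \<open>p\<close>, so \<open>p\<close> itself
    is not below it, and its entries at \<open>i + 1\<close> and \<open>j + 1\<close> survive, so the interval is nontrivial.\<close>
  have S_0: "S K = 0" if K: "K \<subseteq> {i, j}" "K \<noteq> {}" for K
  proof -
    have "{i + 1, j + 1} \<subseteq> {k. k < length p \<and> k \<in> - K}"
      using bounds disj K by auto
    then have "card {i + 1, j + 1} \<le> length (nths p (- K))"
      unfolding length_nths by (intro card_mono) auto
    moreover have "card {i + 1, j + 1} = 2"
      using disj by auto
    ultimately have long: "2 \<le> length (nths p (- K))"
      by simp
    have "{k. k < length p \<and> k \<in> - K} \<subset> {..<length p}"
      using bounds K by force
    then have short: "length (nths p (- K)) < length p"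
      unfolding length_nths using psubset_card_mono[of "{..<length p}"] by simp
    have "l \<noteq> p" if "l \<preceq> nths p (- K)" for l
      using pattern_le_length[OF that] short by auto
    moreover have "nths p (- K) \<preceq> p"
      using pattern_le_nths_mono[OF pattern_le_refl, where J = UNIV] by (simp add: nths_all)
    ultimately have "below \<inter> {l. l \<preceq> nths p (- K)} = {l. is_perm l \<and> [1] \<preceq> l \<and> l \<preceq> nths p (- K)}"
      using pattern_le_trans by (auto simp: below_def pattern_less_def)
    moreover have "finite below"
      by (simp only: below_def finite_below)
    then have "S K = (\<Sum>l\<in>below \<inter> {l. l \<preceq> nths p (- K)}. mobius [1] l)"
      by (simp add: S_def sum.inter_restrict)
    ultimately show ?thesis
      using sum_mobius_one_pattern_le[OF distinct_nthsI[OF dist] long] by simp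
  qed
  have "mobius [1] l = of_bool (l \<preceq> nths p (- {i})) * mobius [1] l
      + of_bool (l \<preceq> nths p (- {j})) * mobius [1] l - of_bool (l \<preceq> nths p (- {i, j})) * mobius [1] l"
    if "l \<in> below" for l
  proof (cases "opposing_adjacencies l")
    case True
    then have "mobius [1] l = 0"
      using that less.hyps[of l] pattern_less_length[of l p] less.prems(1) by (simp add: below_def)
    then show ?thesis
      by simp
  next
    case False
    have "(1 :: int) = of_bool (l \<preceq> nths p (- {i})) + of_bool (l \<preceq> nths p (- {j}))
        - of_bool (l \<preceq> nths p (- {i, j}))"
      using pattern_le_opposing_inclusion_exclusion[OF dist ij _ False] that
      by (simp add: below_def pattern_less_def)
    then show ?thesis
      by (metis distrib_right left_diff_distrib mult_1)
  qed
  then have "(\<Sum>l\<in>below. mobius [1] l) = S {i} + S {j} - S {i, j}"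
    unfolding S_def sum.distrib[symmetric] sum_subtractf[symmetric] by (intro sum.cong) auto
  also have "\<dots> = 0"
    by (simp add: S_0)
  finally have "(\<Sum>l\<in>below. mobius [1] l) = 0" .
  moreover have "p \<noteq> [1]"
    using bounds by auto
  ultimately show ?case
    by (subst mobius.simps) (auto simp: below_def)
qed

end
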